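(* The multiplication operator $M_z$, $M_zf=zf$, on $S_1^2(\mathbb{D})$ is a strict $3$-isometry.
   Context: $\mathbb{D}$ is the open unit disk and $H(\mathbb{D})$ the space of analytic functions on $\mathbb{D}$; for $f\in H(\mathbb{D})$ write $f(z)=\sum_{n\ge 0}f_nz^n$. The derivative Hardy space is the Hilbert space $S_1^2(\mathbb{D})=\{f\in H(\mathbb{D}):\|f\|_{S_1^2}^2=\sum_{n\ge0}\frac{(n+1)(n+2)}{2}|f_n|^2<\infty\}$. A bounded operator $T$ on a Hilbert space $H$ is an $m$-isometry ($m\ge1$ an integer) if $\sum_{k=0}^m(-1)^{m-k}\binom{m}{k}\|T^kh\|^2=0$ for all $h\in H$; it is a strict $m$-isometry if it is an $m$-isometry but not an $(m-1)$-isometry. *)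

theory Defs
  imports "HOL-Complex_Analysis.Complex_Analysis" "HOL-Library.Function_Algebras"
begin

section \<open>Operators on complex Hilbert spaces\<close>

text \<open>
  HOL-Analysis has no class of complex inner product spaces. Here a complex Hilbert space is
  a complex subspace \<open>H\<close> of an ambient complex vector space, with an inner product (linear in
  the first argument) that need only be meaningful on \<open>H\<close>. Likewise, an operator on \<open>H\<close> is a
  function on the ambient space, of which only the values on \<open>H\<close> matter.
\<close>

locale complex_hilbert_space = vector_space scale
  for scale :: "complex \<Rightarrow> 'a::ab_group_add \<Rightarrow> 'a" (infixr \<open>*s\<close> 75) +
  fixes H :: "'a set"
    and inner :: "'a \<Rightarrow> 'a \<Rightarrow> complex"
  assumes subspace_H: "subspace H"
    and inner_add_left: "\<lbrakk>x \<in> H; y \<in> H; z \<in> H\<rbrakk> \<Longrightarrow> inner (x + y) z = inner x z + inner y z"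
    and inner_scale_left: "\<lbrakk>x \<in> H; y \<in> H\<rbrakk> \<Longrightarrow> inner (c *s x) y = c * inner x y"
    and inner_commute: "\<lbrakk>x \<in> H; y \<in> H\<rbrakk> \<Longrightarrow> inner y x = cnj (inner x y)"
    and inner_ge_zero: "x \<in> H \<Longrightarrow> 0 \<le> Re (inner x x)"
    and inner_eq_zero: "\<lbrakk>x \<in> H; inner x x = 0\<rbrakk> \<Longrightarrow> x = 0"
    and complete:
      "\<lbrakk>\<And>k. X k \<in> H;
        \<And>e. e > 0 \<Longrightarrow> \<exists>N. \<forall>k\<ge>N. \<forall>l\<ge>N. sqrt (Re (inner (X k - X l) (X k - X l))) < e\<rbrakk>
       \<Longrightarrow> \<exists>L\<in>H. (\<lambda>k. sqrt (Re (inner (X k - L) (X k - L)))) \<longlonglongrightarrow> 0"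
begin

definition hnorm :: "'a \<Rightarrow> real" where
  "hnorm x = sqrt (Re (inner x x))"

definition bounded_operator :: "('a \<Rightarrow> 'a) \<Rightarrow> bool" where
  "bounded_operator T \<longleftrightarrow>
     (\<forall>x\<in>H. T x \<in> H) \<and>
     (\<forall>x\<in>H. \<forall>y\<in>H. T (x + y) = T x + T y) \<and>
     (\<forall>c. \<forall>x\<in>H. T (c *s x) = c *s T x) \<and>
     (\<exists>C. \<forall>x\<in>H. hnorm (T x) \<le> C * hnorm x)"

definition m_isometry :: "nat \<Rightarrow> ('a \<Rightarrow> 'a) \<Rightarrow> bool" where
  "m_isometry m T \<longleftrightarrow>
     m \<ge> 1 \<and> bounded_operator T \<and>
     (\<forall>h\<in>H. (\<Sum>k=0..m. (-1) ^ (m - k) * real (m choose k) * (hnorm ((T ^^ k) h))\<^sup>2) = 0)"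

definition strict_m_isometry :: "nat \<Rightarrow> ('a \<Rightarrow> 'a) \<Rightarrow> bool" where
  "strict_m_isometry m T \<longleftrightarrow> m_isometry m T \<and> \<not> m_isometry (m - 1) T"

end


section \<open>The derivative Hardy space\<close>

definition taylor_coeff :: "(complex \<Rightarrow> complex) \<Rightarrow> nat \<Rightarrow> complex" where
  "taylor_coeff f n = (deriv ^^ n) f 0 / fact n"

definition S12_weight :: "nat \<Rightarrow> real" where
  "S12_weight n = (real n + 1) * (real n + 2) / 2"

text \<open>
  A function on the open unit disk is represented by its extension by zero to the whole plane,
  so that equality of functions on the disk is equality in HOL.
\<close>

definition S12 :: "(complex \<Rightarrow> complex) set" where
  "S12 = {f. f holomorphic_on ball 0 1 \<and> (\<forall>z. z \<notin> ball 0 1 \<longrightarrow> f z = 0) \<and>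
             summable (\<lambda>n. S12_weight n * (cmod (taylor_coeff f n))\<^sup>2)}"

definition S12_inner :: "(complex \<Rightarrow> complex) \<Rightarrow> (complex \<Rightarrow> complex) \<Rightarrow> complex" where
  "S12_inner f g =
     (\<Sum>n. of_real (S12_weight n) * (taylor_coeff f n * cnj (taylor_coeff g n)))"

definition fun_scale :: "complex \<Rightarrow> (complex \<Rightarrow> complex) \<Rightarrow> complex \<Rightarrow> complex" where
  "fun_scale c f = (\<lambda>z. c * f z)"

definition mult_z :: "(complex \<Rightarrow> complex) \<Rightarrow> complex \<Rightarrow> complex" where
  "mult_z f = (\<lambda>z. z * f z)"


subsection \<open>It is a Hilbert space\<close>

lemma S12_weight_ge_1: "1 \<le> S12_weight n"
  by (simp add: S12_weight_def algebra_simps)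

lemma S12_weight_nonneg [simp]: "0 \<le> S12_weight n"
  using S12_weight_ge_1[of n] by linarith

definition wl2 :: "(nat \<Rightarrow> complex) \<Rightarrow> bool" where
  "wl2 a \<longleftrightarrow> summable (\<lambda>n. S12_weight n * (cmod (a n))\<^sup>2)"

lemma wl2_add:
  assumes "wl2 a" "wl2 b" shows "wl2 (\<lambda>n. a n + b n)"
  unfolding wl2_def
proof (rule summable_comparison_test')
  show "summable (\<lambda>n. 2 * (S12_weight n * (cmod (a n))\<^sup>2) + 2 * (S12_weight n * (cmod (b n))\<^sup>2))"
    using assms unfolding wl2_def by (intro summable_add summable_mult)
  fix n :: nat
  have "(cmod (a n + b n))\<^sup>2 \<le> (cmod (a n) + cmod (b n))\<^sup>2"
    by (intro power_mono norm_triangle_ineq norm_ge_zero)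
  also have "\<dots> \<le> 2 * (cmod (a n))\<^sup>2 + 2 * (cmod (b n))\<^sup>2"
    using sum_squares_ge_zero[of "cmod (a n) - cmod (b n)" 0] by (simp add: power2_eq_square algebra_simps)
  finally have "S12_weight n * (cmod (a n + b n))\<^sup>2
      \<le> S12_weight n * (2 * (cmod (a n))\<^sup>2 + 2 * (cmod (b n))\<^sup>2)"
    by (intro mult_left_mono) auto
  then show "norm (S12_weight n * (cmod (a n + b n))\<^sup>2)
      \<le> 2 * (S12_weight n * (cmod (a n))\<^sup>2) + 2 * (S12_weight n * (cmod (b n))\<^sup>2)"
    by (simp add: algebra_simps)
qed

lemma wl2_cmult:
  assumes "wl2 a" shows "wl2 (\<lambda>n. c * a n)"
  using summable_mult[OF assms[unfolded wl2_def], of "(cmod c)\<^sup>2"]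
  by (simp add: wl2_def norm_mult power_mult_distrib mult_ac)

lemma wl2_diff:
  assumes "wl2 a" "wl2 b" shows "wl2 (\<lambda>n. a n - b n)"
  using wl2_add[OF assms(1) wl2_cmult[OF assms(2), of "-1"]] by simp

lemma wl2_inner_summable:
  assumes "wl2 a" "wl2 b"
  shows "summable (\<lambda>n. of_real (S12_weight n) * (a n * cnj (b n)))"
proof (rule summable_comparison_test')
  show "summable (\<lambda>n. S12_weight n * (cmod (a n))\<^sup>2 + S12_weight n * (cmod (b n))\<^sup>2)"
    using assms unfolding wl2_def by (intro summable_add)
  fix n :: nat
  have "cmod (a n) * cmod (b n) \<le> (cmod (a n))\<^sup>2 + (cmod (b n))\<^sup>2"
    using sum_squares_bound[of "cmod (a n)" "cmod (b n)"] mult_nonneg_nonneg[of "cmod (a n)" "cmod (b n)"]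
    by (simp del: mult_nonneg_nonneg)
  then have "S12_weight n * (cmod (a n) * cmod (b n)) \<le> S12_weight n * ((cmod (a n))\<^sup>2 + (cmod (b n))\<^sup>2)"
    by (intro mult_left_mono) auto
  then show "norm (of_real (S12_weight n) * (a n * cnj (b n)))
      \<le> S12_weight n * (cmod (a n))\<^sup>2 + S12_weight n * (cmod (b n))\<^sup>2"
    by (simp add: norm_mult algebra_simps)
qed

lemma wl2_powser_summable:
  assumes "wl2 a" "norm z < 1"
  shows "summable (\<lambda>n. a n * z ^ n)"
proof -
  have "(\<lambda>n. S12_weight n * (cmod (a n))\<^sup>2) \<longlonglongrightarrow> 0"
    using assms(1) unfolding wl2_def by (rule summable_LIMSEQ_zero)
  then have "eventually (\<lambda>n. S12_weight n * (cmod (a n))\<^sup>2 < 1) sequentially"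
    by (rule order_tendstoD) simp
  then obtain N where N: "\<And>n. n \<ge> N \<Longrightarrow> S12_weight n * (cmod (a n))\<^sup>2 < 1"
    unfolding eventually_sequentially by blast
  show ?thesis
  proof (rule summable_comparison_test')
    show "summable (\<lambda>n. norm z ^ n)" using assms(2) by (simp add: summable_geometric)
    fix n assume n: "n \<ge> N"
    have "1 * (cmod (a n))\<^sup>2 \<le> S12_weight n * (cmod (a n))\<^sup>2"
      by (intro mult_right_mono S12_weight_ge_1) auto
    then have "(cmod (a n))\<^sup>2 \<le> 1\<^sup>2" using N[OF n] by simp
    then have "cmod (a n) \<le> 1" by (rule power2_le_imp_le) simp
    then show "norm (a n * z ^ n) \<le> norm z ^ n"
      by (simp add: norm_mult norm_power mult_left_le_one_le)
  qed
qed

lemma taylor_coeff_sums: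
  assumes "f holomorphic_on ball 0 1" "norm z < 1"
  shows "(\<lambda>n. taylor_coeff f n * z ^ n) sums f z"
  using holomorphic_power_series[OF assms(1), of z] assms(2) by (simp add: taylor_coeff_def)

lemma taylor_coeff_unique:
  assumes "\<And>z. norm z < 1 \<Longrightarrow> (\<lambda>n. a n * z ^ n) sums f z"
  shows "taylor_coeff f n = a n"
proof -
  have "f has_fps_expansion Abs_fps a"
    unfolding has_fps_expansion_def
  proof
    have "summable (\<lambda>n. a n * (1/2) ^ n)"
      by (rule sums_summable[OF assms]) simp
    then have "ereal (norm (1/2 :: complex)) \<le> conv_radius a"
      by (rule conv_radius_geI)
    then show "0 < fps_conv_radius (Abs_fps a)"
      unfolding fps_conv_radius_def by (simp add: less_le_trans[rotated] zero_ereal_def)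
    have "eventually (\<lambda>z. z \<in> ball (0::complex) 1) (nhds 0)"
      by (intro eventually_nhds_in_open) auto
    then show "eventually (\<lambda>z. eval_fps (Abs_fps a) z = f z) (nhds 0)"
      by eventually_elim (use assms in \<open>auto simp: eval_fps_def sums_iff\<close>)
  qed
  from fps_nth_fps_expansion[OF this, of n] show ?thesis by (simp add: taylor_coeff_def)
qed

lemma S12_iff:
  "f \<in> S12 \<longleftrightarrow> f holomorphic_on ball 0 1 \<and> (\<forall>z. z \<notin> ball 0 1 \<longrightarrow> f z = 0) \<and> wl2 (taylor_coeff f)"
  by (simp add: S12_def wl2_def)

lemma taylor_coeff_add:
  assumes "f \<in> S12" "g \<in> S12"
  shows "taylor_coeff (f + g) n = taylor_coeff f n + taylor_coeff g n"
proof (rule taylor_coeff_unique)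
  fix z :: complex assume "norm z < 1"
  then show "(\<lambda>n. (taylor_coeff f n + taylor_coeff g n) * z ^ n) sums (f + g) z"
    using sums_add[OF taylor_coeff_sums[of f z] taylor_coeff_sums[of g z]] assms
    by (simp add: S12_iff distrib_right)
qed

lemma taylor_coeff_scale:
  assumes "f \<in> S12"
  shows "taylor_coeff (fun_scale c f) n = c * taylor_coeff f n"
proof (rule taylor_coeff_unique)
  fix z :: complex assume "norm z < 1"
  then show "(\<lambda>n. (c * taylor_coeff f n) * z ^ n) sums fun_scale c f z"
    using sums_mult[OF taylor_coeff_sums[of f z], of c] assms
    by (simp add: S12_iff fun_scale_def mult.assoc)
qed

lemma S12_zero: "0 \<in> S12"
proof -
  have "taylor_coeff 0 = (\<lambda>n. 0)"
    by (rule ext, rule taylor_coeff_unique) simp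
  then show ?thesis by (simp add: S12_iff wl2_def zero_fun_def)
qed

lemma S12_add:
  assumes "f \<in> S12" "g \<in> S12" shows "f + g \<in> S12"
proof -
  have "taylor_coeff (f + g) = (\<lambda>n. taylor_coeff f n + taylor_coeff g n)"
    using taylor_coeff_add[OF assms] by blast
  then show ?thesis using assms wl2_add
    by (auto simp: S12_iff plus_fun_def intro!: holomorphic_intros)
qed

lemma S12_scale:
  assumes "f \<in> S12" shows "fun_scale c f \<in> S12"
proof -
  have "taylor_coeff (fun_scale c f) = (\<lambda>n. c * taylor_coeff f n)"
    using taylor_coeff_scale[OF assms] by blast
  then show ?thesis using assms wl2_cmult
    by (auto simp: S12_iff fun_scale_def intro!: holomorphic_intros)
qed

lemma taylor_coeff_diff:
  assumes "f \<in> S12" "g \<in> S12"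
  shows "taylor_coeff (f - g) n = taylor_coeff f n - taylor_coeff g n"
proof -
  have "f - g = f + fun_scale (-1) g" by (simp add: fun_scale_def fun_eq_iff)
  then show ?thesis
    by (simp only: taylor_coeff_add[OF assms(1) S12_scale[OF assms(2)]] taylor_coeff_scale[OF assms(2)])
      simp
qed

lemma Re_S12_inner_self:
  assumes "wl2 (taylor_coeff f)"
  shows "Re (S12_inner f f) = (\<Sum>n. S12_weight n * (cmod (taylor_coeff f n))\<^sup>2)"
proof -
  have "Re (S12_inner f f) =
      (\<Sum>n. Re (of_real (S12_weight n) * (taylor_coeff f n * cnj (taylor_coeff f n))))"
    unfolding S12_inner_def using wl2_inner_summable[OF assms assms] by (rule Re_suminf)
  also have "\<dots> = (\<Sum>n. S12_weight n * (cmod (taylor_coeff f n))\<^sup>2)"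
    by (simp add: complex_norm_square [symmetric] cmod_power2 power2_eq_square)
  finally show ?thesis .
qed

lemma S12_inner_sums:
  assumes "f \<in> S12" "g \<in> S12"
  shows "(\<lambda>n. of_real (S12_weight n) * (taylor_coeff f n * cnj (taylor_coeff g n)))
    sums S12_inner f g"
  unfolding S12_inner_def using assms
  by (intro summable_sums wl2_inner_summable) (simp_all add: S12_iff)

lemma S12_eq_zero:
  assumes f: "f \<in> S12" and "S12_inner f f = 0" shows "f = 0"
proof -
  have wl2: "wl2 (taylor_coeff f)" using f by (simp add: S12_iff)
  have "(\<Sum>n. S12_weight n * (cmod (taylor_coeff f n))\<^sup>2) = 0"
    using Re_S12_inner_self[OF wl2] assms(2) by simp
  then have c: "S12_weight n * (cmod (taylor_coeff f n))\<^sup>2 = 0" for n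
    using suminf_eq_zero_iff[of "\<lambda>n. S12_weight n * (cmod (taylor_coeff f n))\<^sup>2"] wl2
    by (simp add: wl2_def)
  then have 0: "taylor_coeff f n = 0" for n
    using S12_weight_ge_1[of n] c[of n] by auto
  show "f = 0"
  proof
    fix z show "f z = 0 z"
      using f taylor_coeff_sums[of f z] 0 by (cases "norm z < 1") (auto simp: S12_iff sums_iff)
  qed
qed

lemma S12_surj:
  assumes "wl2 a"
  obtains f where "f \<in> S12" "taylor_coeff f = a"
proof -
  define f where "f z = (if norm z < 1 then \<Sum>n. a n * z ^ n else 0)" for z
  have f: "(\<lambda>n. a n * z ^ n) sums f z" if "norm z < 1" for z
    using summable_sums[OF wl2_powser_summable[OF assms that]] that by (simp add: f_def)
  have "f holomorphic_on ball 0 1"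
    by (rule power_series_holomorphic[where a = a]) (use f in auto)
  moreover have eq: "taylor_coeff f = a"
    by (rule ext, rule taylor_coeff_unique) (rule f)
  ultimately have "f \<in> S12" using assms by (simp add: S12_iff f_def)
  with eq that show thesis by blast
qed

lemma S12_complete:
  assumes X: "\<And>k. X k \<in> S12"
    and cauchy: "\<And>e. e > 0 \<Longrightarrow>
      \<exists>N. \<forall>k\<ge>N. \<forall>l\<ge>N. sqrt (Re (S12_inner (X k - X l) (X k - X l))) < e"
  shows "\<exists>L\<in>S12. (\<lambda>k. sqrt (Re (S12_inner (X k - L) (X k - L)))) \<longlonglongrightarrow> 0"
proof -
  define c where "c k = taylor_coeff (X k)" for k
  have wc: "wl2 (c k)" for k using X by (simp add: c_def S12_iff)
  have cd: "taylor_coeff (X k - X l) = (\<lambda>n. c k n - c l n)" for k l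
    using taylor_coeff_diff[OF X X] by (auto simp: c_def)
  have wd: "wl2 (\<lambda>n. c k n - c l n)" for k l by (intro wl2_diff wc)
  have part: "\<exists>N. \<forall>k\<ge>N. \<forall>l\<ge>N. \<forall>M. (\<Sum>n<M. S12_weight n * (cmod (c k n - c l n))\<^sup>2) \<le> e\<^sup>2"
    if e: "e > 0" for e
  proof -
    from cauchy[OF e] obtain N
      where N: "\<And>k l. k \<ge> N \<Longrightarrow> l \<ge> N \<Longrightarrow> sqrt (Re (S12_inner (X k - X l) (X k - X l))) < e"
      by blast
    have "(\<Sum>n<M. S12_weight n * (cmod (c k n - c l n))\<^sup>2) \<le> e\<^sup>2" if kl: "k \<ge> N" "l \<ge> N" for k l M
    proof -
      have "(\<Sum>n<M. S12_weight n * (cmod (c k n - c l n))\<^sup>2)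
          \<le> (\<Sum>n. S12_weight n * (cmod (c k n - c l n))\<^sup>2)"
        by (rule sum_le_suminf) (use wd[of k l] in \<open>auto simp: wl2_def\<close>)
      also have "\<dots> = Re (S12_inner (X k - X l) (X k - X l))"
        using Re_S12_inner_self[of "X k - X l"] wd[of k l] by (simp add: cd)
      also have "\<dots> \<le> e\<^sup>2" using N[OF kl] by (intro sqrt_le_D) simp
      finally show ?thesis .
    qed
    then show ?thesis by blast
  qed
  have "Cauchy (\<lambda>k. c k n)" for n
  proof (rule metric_CauchyI)
    fix e :: real assume e: "e > 0"
    then have e2: "e / 2 > 0" by simp
    from part[OF e2] obtain N
      where N: "\<And>k l M. k \<ge> N \<Longrightarrow> l \<ge> N \<Longrightarrow> (\<Sum>n<M. S12_weight n * (cmod (c k n - c l n))\<^sup>2) \<le> (e/2)\<^sup>2"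
      by blast
    have "dist (c k n) (c l n) < e" if kl: "k \<ge> N" "l \<ge> N" for k l
    proof -
      have "1 * (cmod (c k n - c l n))\<^sup>2 \<le> S12_weight n * (cmod (c k n - c l n))\<^sup>2"
        by (intro mult_right_mono S12_weight_ge_1) auto
      also have "\<dots> \<le> (\<Sum>i<Suc n. S12_weight i * (cmod (c k i - c l i))\<^sup>2)"
        by (rule member_le_sum) auto
      also have "\<dots> \<le> (e/2)\<^sup>2" by (rule N[OF kl])
      finally have "(cmod (c k n - c l n))\<^sup>2 \<le> (e/2)\<^sup>2" by (simp only: mult_1)
      then have "cmod (c k n - c l n) \<le> e/2"
        by (rule power2_le_imp_le) (use e in simp)
      then show ?thesis using e by (simp add: dist_norm)
    qed
    then show "\<exists>N. \<forall>k\<ge>N. \<forall>l\<ge>N. dist (c k n) (c l n) < e" by blast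
  qed
  then have "\<exists>b. (\<lambda>k. c k n) \<longlonglongrightarrow> b" for n
    by (simp add: Cauchy_convergent_iff convergent_def)
  then obtain a where a: "\<And>n. (\<lambda>k. c k n) \<longlonglongrightarrow> a n" by metis
  have lim: "\<exists>N. \<forall>k\<ge>N. \<forall>M. (\<Sum>n<M. S12_weight n * (cmod (c k n - a n))\<^sup>2) \<le> e\<^sup>2"
    if e: "e > 0" for e
  proof -
    from part[OF e] obtain N
      where N: "\<And>k l M. k \<ge> N \<Longrightarrow> l \<ge> N \<Longrightarrow> (\<Sum>n<M. S12_weight n * (cmod (c k n - c l n))\<^sup>2) \<le> e\<^sup>2"
      by blast
    have "(\<Sum>n<M. S12_weight n * (cmod (c k n - a n))\<^sup>2) \<le> e\<^sup>2" if "k \<ge> N" for k M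
    proof (rule LIMSEQ_le_const2)
      show "(\<lambda>l. \<Sum>n<M. S12_weight n * (cmod (c k n - c l n))\<^sup>2)
          \<longlonglongrightarrow> (\<Sum>n<M. S12_weight n * (cmod (c k n - a n))\<^sup>2)"
        by (intro tendsto_intros a)
      show "\<exists>N. \<forall>l\<ge>N. (\<Sum>n<M. S12_weight n * (cmod (c k n - c l n))\<^sup>2) \<le> e\<^sup>2"
        using N that by blast
    qed
    then show ?thesis by blast
  qed
  have wlim: "wl2 (\<lambda>n. c k n - a n) \<and> (\<Sum>n. S12_weight n * (cmod (c k n - a n))\<^sup>2) \<le> e\<^sup>2"
    if "\<forall>M. (\<Sum>n<M. S12_weight n * (cmod (c k n - a n))\<^sup>2) \<le> e\<^sup>2" for k e
  proof -
    have "summable (\<lambda>n. S12_weight n * (cmod (c k n - a n))\<^sup>2)"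
    proof (rule bounded_imp_summable)
      show "(\<Sum>n\<le>M. S12_weight n * (cmod (c k n - a n))\<^sup>2) \<le> e\<^sup>2" for M
        using that by (metis lessThan_Suc_atMost)
    qed auto
    then show ?thesis
      using suminf_le_const that by (auto simp: wl2_def)
  qed
  have "wl2 a"
  proof -
    from lim[of 1] obtain k where "\<forall>M. (\<Sum>n<M. S12_weight n * (cmod (c k n - a n))\<^sup>2) \<le> 1\<^sup>2"
      by auto
    then have "wl2 (\<lambda>n. c k n - a n)" using wlim by blast
    from wl2_diff[OF wc[of k] this] show ?thesis by simp
  qed
  then obtain L where L: "L \<in> S12" "taylor_coeff L = a" by (rule S12_surj)
  have cL: "taylor_coeff (X k - L) = (\<lambda>n. c k n - a n)" for k
    using taylor_coeff_diff[OF X L(1)] L(2) by (auto simp: c_def)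
  have "(\<lambda>k. sqrt (Re (S12_inner (X k - L) (X k - L)))) \<longlonglongrightarrow> 0"
  proof (rule LIMSEQ_I)
    fix r :: real assume r: "r > 0"
    then have "r / 2 > 0" by simp
    from lim[OF this] obtain N
      where N: "\<And>k. k \<ge> N \<Longrightarrow> \<forall>M. (\<Sum>n<M. S12_weight n * (cmod (c k n - a n))\<^sup>2) \<le> (r/2)\<^sup>2"
      by blast
    have "norm (sqrt (Re (S12_inner (X k - L) (X k - L))) - 0) < r" if "k \<ge> N" for k
    proof -
      have w: "wl2 (\<lambda>n. c k n - a n)"
        and le: "(\<Sum>n. S12_weight n * (cmod (c k n - a n))\<^sup>2) \<le> (r/2)\<^sup>2"
        using wlim[OF N[OF that]] by auto
      have eq: "Re (S12_inner (X k - L) (X k - L)) = (\<Sum>n. S12_weight n * (cmod (c k n - a n))\<^sup>2)"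
        using Re_S12_inner_self[of "X k - L"] w by (simp add: cL)
      have "0 \<le> Re (S12_inner (X k - L) (X k - L))"
        unfolding eq by (rule suminf_nonneg) (use w in \<open>auto simp: wl2_def\<close>)
      moreover have "sqrt (Re (S12_inner (X k - L) (X k - L))) \<le> r/2"
        unfolding eq using le r by (intro real_le_lsqrt) auto
      ultimately show ?thesis using r by simp
    qed
    then show "\<exists>N. \<forall>k\<ge>N. norm (sqrt (Re (S12_inner (X k - L) (X k - L))) - 0) < r" by blast
  qed
  with L(1) show ?thesis by blast
qed

interpretation S12: complex_hilbert_space fun_scale S12 S12_inner
proof -
  interpret vector_space fun_scale
    by standard (auto simp: fun_scale_def fun_eq_iff algebra_simps)
  show "complex_hilbert_space fun_scale S12 S12_inner"
  proof
    show "subspace S12"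
      by (intro subspaceI S12_zero S12_add S12_scale)
  next
    fix x y z assume xyz: "x \<in> S12" "y \<in> S12" "z \<in> S12"
    then have "(\<lambda>n. of_real (S12_weight n) * (taylor_coeff x n * cnj (taylor_coeff z n))
          + of_real (S12_weight n) * (taylor_coeff y n * cnj (taylor_coeff z n)))
        sums (S12_inner x z + S12_inner y z)"
      by (intro sums_add S12_inner_sums)
    moreover have "(\<lambda>n. of_real (S12_weight n) * (taylor_coeff x n * cnj (taylor_coeff z n))
          + of_real (S12_weight n) * (taylor_coeff y n * cnj (taylor_coeff z n)))
        = (\<lambda>n. of_real (S12_weight n) * (taylor_coeff (x + y) n * cnj (taylor_coeff z n)))"
      by (rule ext) (simp only: taylor_coeff_add[OF xyz(1,2)] distrib_left distrib_right)
    ultimately show "S12_inner (x + y) z = S12_inner x z + S12_inner y z"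
      using S12_inner_sums[OF S12_add[OF xyz(1,2)] xyz(3)] by (metis sums_unique2)
  next
    fix x y c assume xy: "x \<in> S12" "y \<in> S12"
    then have "(\<lambda>n. c * (of_real (S12_weight n) * (taylor_coeff x n * cnj (taylor_coeff y n))))
        sums (c * S12_inner x y)"
      by (intro sums_mult S12_inner_sums)
    moreover have "(\<lambda>n. c * (of_real (S12_weight n) * (taylor_coeff x n * cnj (taylor_coeff y n))))
        = (\<lambda>n. of_real (S12_weight n) * (taylor_coeff (fun_scale c x) n * cnj (taylor_coeff y n)))"
      by (rule ext) (simp only: taylor_coeff_scale[OF xy(1)] mult_ac)
    ultimately show "S12_inner (fun_scale c x) y = c * S12_inner x y"
      using S12_inner_sums[OF S12_scale[OF xy(1)] xy(2)] by (metis sums_unique2)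
  next
    fix x y assume "x \<in> S12" "y \<in> S12"
    then have "(\<lambda>n. cnj (of_real (S12_weight n) * (taylor_coeff x n * cnj (taylor_coeff y n))))
        sums cnj (S12_inner x y)"
      by (simp only: sums_cnj S12_inner_sums)
    then show "S12_inner y x = cnj (S12_inner x y)"
      by (simp add: S12_inner_def sums_iff mult_ac)
  next
    fix x assume "x \<in> S12"
    then show "0 \<le> Re (S12_inner x x)"
      by (auto simp: Re_S12_inner_self S12_iff wl2_def intro!: suminf_nonneg)
  qed (use S12_eq_zero S12_complete in blast)+
qed

lemma S12_norm_square:
  assumes "f \<in> S12"
  shows "(S12.hnorm f)\<^sup>2 = (\<Sum>n. S12_weight n * (cmod (taylor_coeff f n))\<^sup>2)"
  using assms S12.inner_ge_zero[OF assms]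
  by (simp add: S12.hnorm_def Re_S12_inner_self S12_iff)

end

theory Submission
  imports Defs
begin

text \<open>
  In Taylor coefficients \<open>M\<^sub>z\<close> is the unilateral shift, so \<open>M\<^sub>z\<^sup>k\<close> turns the weight \<open>w n\<close> of the
  norm into \<open>w (n + k)\<close> (lemma \<open>norm_mult_z_power_sums\<close>). The alternating binomial sum that
  defines an \<open>m\<close>-isometry is therefore the norm square taken with the \<open>m\<close>-th forward difference of
  \<open>w\<close> in place of \<open>w\<close> (lemma \<open>isometry_defect_sums\<close>). The weight \<open>w n = (n + 1) (n + 2) / 2\<close> is a
  quadratic polynomial with leading coefficient \<open>1/2\<close>: its third difference vanishes, which gives
  the 3-isometry, while its second difference is constantly 1, so that the sum for \<open>m = 2\<close> is the
  norm square of the classical Hardy space, which is not zero on the constant function 1.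
\<close>

lemma taylor_coeff_mult_z:
  assumes "f \<in> S12"
  shows "taylor_coeff (mult_z f) n = (case n of 0 \<Rightarrow> 0 | Suc j \<Rightarrow> taylor_coeff f j)"
proof (rule taylor_coeff_unique)
  fix z :: complex assume z: "norm z < 1"
  let ?s = "\<lambda>n. (case n of 0 \<Rightarrow> 0 | Suc j \<Rightarrow> taylor_coeff f j) * z ^ n"
  have "(\<lambda>j. z * (taylor_coeff f j * z ^ j)) sums (z * f z)"
    using assms z by (intro sums_mult taylor_coeff_sums) (simp_all add: S12_iff)
  then have "(\<lambda>j. ?s (Suc j)) sums (z * f z)"
    by (simp add: mult_ac)
  then show "?s sums mult_z f z"
    by (subst (asm) sums_Suc_iff) (simp add: mult_z_def)
qed

lemma S12_weight_Suc_le: "S12_weight (Suc n) \<le> 3 * S12_weight n"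
  by (simp add: S12_weight_def algebra_simps)

lemma S12_norm_sums:
  assumes "f \<in> S12"
  shows "(\<lambda>n. S12_weight n * (cmod (taylor_coeff f n))\<^sup>2) sums (S12.hnorm f)\<^sup>2"
  unfolding S12_norm_square[OF assms] using assms
  by (intro summable_sums) (simp add: S12_def)

lemma mult_z_in_S12:
  assumes "f \<in> S12"
  shows "mult_z f \<in> S12"
proof -
  have "summable (\<lambda>n. S12_weight (Suc n) * (cmod (taylor_coeff f n))\<^sup>2)"
  proof (rule summable_comparison_test')
    show "summable (\<lambda>n. 3 * (S12_weight n * (cmod (taylor_coeff f n))\<^sup>2))"
      using S12_norm_sums[OF assms] by (intro summable_mult) (rule sums_summable)
    fix n :: nat
    show "norm (S12_weight (Suc n) * (cmod (taylor_coeff f n))\<^sup>2)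
        \<le> 3 * (S12_weight n * (cmod (taylor_coeff f n))\<^sup>2)"
      using mult_right_mono[OF S12_weight_Suc_le[of n], of "(cmod (taylor_coeff f n))\<^sup>2"] by simp
  qed
  then have "summable (\<lambda>n. S12_weight n * (cmod (taylor_coeff (mult_z f) n))\<^sup>2)"
    by (subst summable_Suc_iff[symmetric]) (simp add: taylor_coeff_mult_z[OF assms])
  then show ?thesis
    using assms by (auto simp: S12_def mult_z_def intro!: holomorphic_intros)
qed

text \<open>
  Peeling the innermost factor off \<open>M\<^sub>z\<^sup>k\<close> keeps the induction one index shift per step: the
  coefficient of index 0 of \<open>z f\<close> vanishes, so its series starts at index 1.
\<close>

lemma norm_mult_z_power_sums:
  assumes "f \<in> S12"
  shows "(\<lambda>n. S12_weight (n + k) * (cmod (taylor_coeff f n))\<^sup>2)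
    sums (S12.hnorm ((mult_z ^^ k) f))\<^sup>2"
  using assms
proof (induction k arbitrary: f)
  case 0
  then show ?case using S12_norm_sums by simp
next
  case (Suc k)
  let ?s = "\<lambda>n. S12_weight (n + k) * (cmod (taylor_coeff (mult_z f) n))\<^sup>2"
  have "?s sums (S12.hnorm ((mult_z ^^ Suc k) f))\<^sup>2"
    using Suc.IH[OF mult_z_in_S12[OF Suc.prems]] by (simp add: funpow_Suc_right del: funpow.simps)
  then have "(\<lambda>n. ?s (Suc n)) sums (S12.hnorm ((mult_z ^^ Suc k) f))\<^sup>2"
    by (subst sums_Suc_iff) (simp add: taylor_coeff_mult_z[OF Suc.prems])
  then show ?case
    by (simp add: taylor_coeff_mult_z[OF Suc.prems])
qed

lemma isometry_defect_sums:
  assumes "f \<in> S12"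
  shows "(\<lambda>n. (\<Sum>k=0..m. (-1) ^ (m - k) * real (m choose k) * S12_weight (n + k))
          * (cmod (taylor_coeff f n))\<^sup>2)
    sums (\<Sum>k=0..m. (-1) ^ (m - k) * real (m choose k) * (S12.hnorm ((mult_z ^^ k) f))\<^sup>2)"
proof -
  have "(\<lambda>n. \<Sum>k=0..m. (-1) ^ (m - k) * real (m choose k)
          * (S12_weight (n + k) * (cmod (taylor_coeff f n))\<^sup>2))
    sums (\<Sum>k=0..m. (-1) ^ (m - k) * real (m choose k) * (S12.hnorm ((mult_z ^^ k) f))\<^sup>2)"
    by (intro sums_sum sums_mult norm_mult_z_power_sums assms)
  then show ?thesis
    by (simp add: sum_distrib_right mult.assoc)
qed

lemma S12_weight_second_difference:
  "(\<Sum>k=0..2. (-1) ^ (2 - k) * real (2 choose k) * S12_weight (n + k)) = 1"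
  by (simp add: S12_weight_def numeral_eq_Suc field_simps)

lemma S12_weight_third_difference:
  "(\<Sum>k=0..3. (-1) ^ (3 - k) * real (3 choose k) * S12_weight (n + k)) = 0"
  by (simp add: S12_weight_def numeral_eq_Suc field_simps)

text \<open>
  The ratio \<open>w (n + 1) / w n = (n + 3) / (n + 1)\<close> is largest at \<open>n = 0\<close>, whence the bound
  \<open>sqrt 3\<close> on the operator norm.
\<close>

lemma bounded_operator_mult_z: "S12.bounded_operator mult_z"
proof -
  have "S12.hnorm (mult_z f) \<le> sqrt 3 * S12.hnorm f" if f: "f \<in> S12" for f
  proof (rule power2_le_imp_le)
    have "(S12.hnorm (mult_z f))\<^sup>2 \<le> 3 * (S12.hnorm f)\<^sup>2"
    proof (rule sums_le)
      show "(\<lambda>n. S12_weight (Suc n) * (cmod (taylor_coeff f n))\<^sup>2) sums (S12.hnorm (mult_z f))\<^sup>2"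
        using norm_mult_z_power_sums[OF f, of 1] by simp
      show "(\<lambda>n. 3 * (S12_weight n * (cmod (taylor_coeff f n))\<^sup>2)) sums (3 * (S12.hnorm f)\<^sup>2)"
        by (intro sums_mult S12_norm_sums f)
      show "S12_weight (Suc n) * (cmod (taylor_coeff f n))\<^sup>2
          \<le> 3 * (S12_weight n * (cmod (taylor_coeff f n))\<^sup>2)" for n
        using mult_right_mono[OF S12_weight_Suc_le[of n], of "(cmod (taylor_coeff f n))\<^sup>2"] by simp
    qed
    then show "(S12.hnorm (mult_z f))\<^sup>2 \<le> (sqrt 3 * S12.hnorm f)\<^sup>2"
      by (simp add: power_mult_distrib)
    show "0 \<le> sqrt 3 * S12.hnorm f"
      using S12.inner_ge_zero[OF f] by (simp add: S12.hnorm_def)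
  qed
  moreover have "mult_z (f + g) = mult_z f + mult_z g" for f g
    by (simp add: mult_z_def fun_eq_iff distrib_left)
  moreover have "mult_z (fun_scale c f) = fun_scale c (mult_z f)" for c f
    by (simp add: mult_z_def fun_scale_def fun_eq_iff)
  ultimately show ?thesis
    unfolding S12.bounded_operator_def
    by (intro conjI ballI allI exI[of _ "sqrt 3"]) (simp_all add: mult_z_in_S12)
qed

lemma m_isometry_3_mult_z: "S12.m_isometry 3 mult_z"
proof -
  have "(\<Sum>k=0..3. (-1) ^ (3 - k) * real (3 choose k) * (S12.hnorm ((mult_z ^^ k) f))\<^sup>2) = 0"
    if "f \<in> S12" for f
    using isometry_defect_sums[OF that, of 3]
    by (simp only: S12_weight_third_difference) (simp add: sums_iff)
  then show ?thesis
    by (simp add: S12.m_isometry_def bounded_operator_mult_z)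
qed

lemma not_m_isometry_2_mult_z: "\<not> S12.m_isometry 2 mult_z"
proof
  assume iso: "S12.m_isometry 2 mult_z"
  \<comment> \<open>The witness is the constant function 1 on the disk, given by its coefficients.\<close>
  define a :: "nat \<Rightarrow> complex" where "a n = (if n = 0 then 1 else 0)" for n
  have "wl2 a"
    unfolding wl2_def by (rule summable_finite[of "{0}"]) (auto simp: a_def)
  then obtain f where f: "f \<in> S12" "taylor_coeff f = a"
    by (rule S12_surj)
  have "(\<Sum>k=0..2. (-1) ^ (2 - k) * real (2 choose k) * (S12.hnorm ((mult_z ^^ k) f))\<^sup>2) = 0"
    using iso f(1) unfolding S12.m_isometry_def by blast
  then have "(\<lambda>n. (cmod (a n))\<^sup>2) sums 0"
    using isometry_defect_sums[OF f(1), of 2]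
    by (simp only: S12_weight_second_difference f(2) mult_1)
  moreover have "(\<lambda>n. (cmod (a n))\<^sup>2) sums 1"
    using sums_finite[of "{0}" "\<lambda>n. (cmod (a n))\<^sup>2"] by (simp add: a_def)
  ultimately have "(0::real) = 1"
    by (rule sums_unique2)
  then show False by simp
qed

theorem lemma3p2:
  shows "S12.strict_m_isometry 3 mult_z"
  using m_isometry_3_mult_z not_m_isometry_2_mult_z
  by (simp add: S12.strict_m_isometry_def)

end
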